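(* Let $n,N\ge1$ be integers and let $\boldsymbol{\lambda}=(\lambda_1,\ldots,\lambda_n)$ with $\lambda_i>0$ for all $i$ and $\sum_{i=1}^n\lambda_i=1$. (1) For every $\mu>0$, the resolvent average matrix function $$(A_1,\ldots,A_n)\mapsto\big[\lambda_1(A_1+\mu^{-1}\mathrm{Id})^{-1}+\cdots+\lambda_n(A_n+\mu^{-1}\mathrm{Id})^{-1}\big]^{-1}-\mu^{-1}\mathrm{Id}$$ is matrix concave on $\mathbb{S}^N_{++}\times\cdots\times\mathbb{S}^N_{++}$ ($n$ factors). (2) The harmonic average matrix function $$(A_1,\ldots,A_n)\mapsto(\lambda_1A_1^{-1}+\cdots+\lambda_nA_n^{-1})^{-1}$$ is matrix concave on $\mathbb{S}^N_{++}\times\cdots\times\mathbb{S}^N_{++}$ ($n$ factors). (3) Consequently, the function $$(x_1,\ldots,x_n)\mapsto\frac{1}{x_1^{-1}+\cdots+x_n^{-1}}$$ is concave on $\mathbb{R}_{++}\times\cdots\times\mathbb{R}_{++}$ ($n$ factors).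
   Context: $\mathbb{S}^N$ is the space of real symmetric $N\times N$ matrices, $\mathbb{S}^N_{++}$ the set of positive definite ones, $\mathbb{S}^N_+$ the set of positive semidefinite ones; for $X,Y\in\mathbb{S}^N$, $Y\preceq X$ means $X-Y\in\mathbb{S}^N_+$. $\mathrm{Id}$ is the $N\times N$ identity matrix and $\mathbb{R}_{++}=\,]0,+\infty[$. A function $g\colon\mathbb{D}\to\mathbb{S}^N$ on a convex set $\mathbb{D}$ (here $\mathbb{D}=\mathbb{S}^N_{++}\times\cdots\times\mathbb{S}^N_{++}$, with componentwise addition and scalar multiplication) is matrix concave if for all $X,Y\in\mathbb{D}$ and all $t\in[0,1]$, $t\,g(X)+(1-t)g(Y)\preceq g(tX+(1-t)Y)$. *)

theory Defs
  imports "HOL-Analysis.Analysis"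
begin

definition symmetric_matrices :: "(real^'m^'m) set" where
  "symmetric_matrices = {A. transpose A = A}"

definition psd_matrices :: "(real^'m^'m) set" where
  "psd_matrices = {A \<in> symmetric_matrices. \<forall>x. 0 \<le> x \<bullet> (A *v x)}"

definition pd_matrices :: "(real^'m^'m) set" where
  "pd_matrices = {A \<in> symmetric_matrices. \<forall>x. x \<noteq> 0 \<longrightarrow> 0 < x \<bullet> (A *v x)}"

(* The order \<le> that the library puts on vectors is the componentwise one,
   so the Loewner order needs its own symbol. *)
definition loewner_le :: "real^'m^'m \<Rightarrow> real^'m^'m \<Rightarrow> bool" (infix "\<preceq>" 50) where
  "Y \<preceq> X \<longleftrightarrow> X - Y \<in> psd_matrices"

(* Convexity of the domain and g mapping it into the symmetric matrices are
   part of the notion. *)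
definition matrix_concave_on :: "'a::real_vector set \<Rightarrow> ('a \<Rightarrow> real^'m^'m) \<Rightarrow> bool" where
  "matrix_concave_on D g \<longleftrightarrow>
     convex D \<and> (\<forall>X\<in>D. g X \<in> symmetric_matrices) \<and>
     (\<forall>X\<in>D. \<forall>Y\<in>D. \<forall>t. 0 \<le> t \<and> t \<le> 1 \<longrightarrow>
        t *\<^sub>R g X + (1 - t) *\<^sub>R g Y \<preceq> g (t *\<^sub>R X + (1 - t) *\<^sub>R Y))"

(* An n-tuple of m x m matrices is an element of real^'m^'m^'n, whose i-th matrix is A $ i;
   the vector space structure of this type is the componentwise one. *)
definition pd_tuples :: "(real^'m^'m^'n) set" where
  "pd_tuples = {A. \<forall>i. A $ i \<in> pd_matrices}"

definition resolvent_average :: "real \<Rightarrow> real^'n \<Rightarrow> real^'m^'m^'n \<Rightarrow> real^'m^'m" where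
  "resolvent_average \<mu> lam A =
     matrix_inv (\<Sum>i\<in>UNIV. lam $ i *\<^sub>R matrix_inv (A $ i + inverse \<mu> *\<^sub>R mat 1))
       - inverse \<mu> *\<^sub>R mat 1"

definition harmonic_average :: "real^'n \<Rightarrow> real^'m^'m^'n \<Rightarrow> real^'m^'m" where
  "harmonic_average lam A = matrix_inv (\<Sum>i\<in>UNIV. lam $ i *\<^sub>R matrix_inv (A $ i))"

end

(* The quadratic form of H = (sum lam_i A_i^-1)^-1 is an infimum of functions linear in A:
     x . H x = min { sum lam_i y_i . A_i y_i  |  sum lam_i y_i = x },
   attained at y_i = A_i^-1 H x; the inequality is obtained by expanding the nonnegative sum of
   lam_i (y_i - A_i^-1 H x) . A_i (y_i - A_i^-1 H x).  Hence H is concave.  The resolvent average is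
   a translate of H at a translated tuple, and the scalar statement is the case lam_i = 1 for
   multiples of the identity. *)
theory Submission
  imports Defs
begin

section \<open>Symmetric and positive definite matrices\<close>

lemma scaleR_matrix_vector_mult: "(c *\<^sub>R A) *v x = c *\<^sub>R (A *v x)"
  for A :: "real^'n^'m"
  by (simp add: scaleR_matrix_vector_assoc)

lemma sum_matrix_vector_mult:
  "(\<Sum>i\<in>I. A i) *v x = (\<Sum>i\<in>I. A i *v x)" for A :: "'i \<Rightarrow> real^'n^'m"
  by (induction I rule: infinite_finite_induct) (simp_all add: matrix_vector_mult_add_rdistrib)

text \<open>Moving \<open>A\<close> across the inner product produces its transpose, and a vector is
  determined by its inner products with all vectors. This self-adjoint form is the one used in every
  later symmetry argument.\<close>

lemma symmetric_matrices_iff_inner: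
  "A \<in> symmetric_matrices \<longleftrightarrow> (\<forall>x y. x \<bullet> (A *v y) = (A *v x) \<bullet> y)"
proof -
  have "transpose A = A" if "\<forall>x y. x \<bullet> (A *v y) = (A *v x) \<bullet> y"
  proof -
    have "transpose A *v x = A *v x" for x
      by (rule vector_eq_rdot[THEN iffD1]) (metis that dot_lmul_matrix transpose_matrix_vector)
    then show ?thesis
      by (simp add: matrix_eq)
  qed
  then show ?thesis
    by (auto simp: symmetric_matrices_def) (metis dot_lmul_matrix transpose_matrix_vector)
qed

lemma pd_matrices_iff:
  "A \<in> pd_matrices \<longleftrightarrow> A \<in> symmetric_matrices \<and> (\<forall>x. x \<noteq> 0 \<longrightarrow> 0 < x \<bullet> (A *v x))"
  by (simp add: pd_matrices_def)

lemma subspace_symmetric_matrices: "subspace (symmetric_matrices :: (real^'m^'m) set)"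
  by (auto simp: subspace_def symmetric_matrices_iff_inner matrix_vector_mult_add_rdistrib
      scaleR_matrix_vector_mult inner_simps)

lemma mat_1_symmetric: "mat 1 \<in> symmetric_matrices"
  by (simp add: symmetric_matrices_def)

lemma mat_1_pd: "mat 1 \<in> pd_matrices"
  by (simp add: pd_matrices_iff mat_1_symmetric)

lemma pd_add: "A \<in> pd_matrices \<Longrightarrow> B \<in> pd_matrices \<Longrightarrow> A + B \<in> pd_matrices"
  by (auto simp: pd_matrices_iff subspace_add[OF subspace_symmetric_matrices]
      matrix_vector_mult_add_rdistrib inner_simps add_pos_pos)

lemma pd_scaleR: "0 < c \<Longrightarrow> A \<in> pd_matrices \<Longrightarrow> c *\<^sub>R A \<in> pd_matrices"
  by (auto simp: pd_matrices_iff subspace_scale[OF subspace_symmetric_matrices]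
      scaleR_matrix_vector_mult)

text \<open>Nonemptiness matters: the empty sum is the zero matrix, which is not positive
  definite.\<close>

lemma pd_sum:
  assumes "finite I" "I \<noteq> {}" "\<And>i. i \<in> I \<Longrightarrow> A i \<in> pd_matrices"
  shows "(\<Sum>i\<in>I. A i) \<in> pd_matrices"
  using assms by (induction I rule: finite_ne_induct) (auto intro: pd_add)

lemma pd_quadratic_nonneg: "A \<in> pd_matrices \<Longrightarrow> 0 \<le> x \<bullet> (A *v x)"
  by (cases "x = 0") (auto simp: pd_matrices_iff intro: less_imp_le)

text \<open>A kernel vector makes the quadratic form vanish, so it is zero; a square matrix with
  trivial kernel is invertible.\<close>

lemma pd_invertible:
  assumes "A \<in> pd_matrices"
  shows "invertible A"
proof -
  have "x = 0" if "A *v x = 0" for x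
    using assms that by (force simp: pd_matrices_iff)
  then show ?thesis
    by (simp add: invertible_left_inverse matrix_left_invertible_ker)
qed

section \<open>Inverses of positive definite matrices\<close>

lemma matrix_inv_mult:
  fixes A :: "'a::semiring_1^'n^'m"
  assumes "invertible A"
  shows "A ** matrix_inv A = mat 1" "matrix_inv A ** A = mat 1"
  using someI_ex[OF assms[unfolded invertible_def]] by (simp_all add: matrix_inv_def)

lemma matrix_inv_unique:
  fixes A :: "'a::semiring_1^'n^'m"
  assumes "A ** B = mat 1" "B ** A = mat 1"
  shows "matrix_inv A = B"
proof -
  have "invertible A"
    using assms by (auto simp: invertible_def)
  then show ?thesis
    using assms by (metis matrix_inv_mult(2) matrix_mul_assoc matrix_mul_lid matrix_mul_rid)
qed

lemma pd_mult_inv_vector [simp]: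
  "A \<in> pd_matrices \<Longrightarrow> A *v (matrix_inv A *v x) = x"
  "A \<in> pd_matrices \<Longrightarrow> matrix_inv A *v (A *v x) = x"
  by (simp_all add: matrix_vector_mul_assoc pd_invertible matrix_inv_mult)

text \<open>The substitution u = A^-1 x turns x . A^-1 x into A u . u, so symmetry and definiteness
  pass from \<open>A\<close> to its inverse.\<close>

lemma pd_inv:
  assumes "A \<in> pd_matrices"
  shows "matrix_inv A \<in> pd_matrices"
proof -
  let ?B = "matrix_inv A"
  have sym: "(A *v u) \<bullet> v = u \<bullet> (A *v v)" for u v
    using assms by (simp add: pd_matrices_iff symmetric_matrices_iff_inner)
  have "x \<bullet> (?B *v y) = (?B *v x) \<bullet> y" for x y
    using sym[of "?B *v x" "?B *v y"] assms by simp
  moreover have "0 < x \<bullet> (?B *v x)" if "x \<noteq> 0" for x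
  proof -
    have "?B *v x \<noteq> 0"
      using assms that by (metis matrix_vector_mult_0_right pd_mult_inv_vector(1))
    then have "0 < (?B *v x) \<bullet> (A *v (?B *v x))"
      \<comment> \<open>The cancellation rule is switched off because it would collapse A (A^-1 x)
        to x before definiteness of \<open>A\<close> is applied at A^-1 x.\<close>
      using assms by (simp add: pd_matrices_iff del: pd_mult_inv_vector)
    then show ?thesis
      using assms by (simp add: inner_commute)
  qed
  ultimately show ?thesis
    by (simp add: pd_matrices_iff symmetric_matrices_iff_inner)
qed

lemma convex_pd_tuples: "convex (pd_tuples :: (real^'m^'m^'n) set)"
proof -
  have "u *\<^sub>R A + v *\<^sub>R B \<in> pd_matrices"
    if "A \<in> pd_matrices" "B \<in> pd_matrices" "0 \<le> u" "0 \<le> v" "u + v = 1"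
    for A B :: "real^'m^'m" and u v
    \<comment> \<open>The endpoints are split off because scaling preserves definiteness only for a
      strictly positive factor.\<close>
    using that by (cases "u = 0"; cases "v = 0") (auto intro!: pd_add pd_scaleR simp: less_le)
  then show ?thesis
    by (auto simp: convex_def pd_tuples_def)
qed

section \<open>Variational formula for the harmonic average\<close>

lemma harmonic_average_pd:
  assumes "\<And>i. 0 < lam $ i" "A \<in> pd_tuples"
  shows "(\<Sum>i\<in>UNIV. lam $ i *\<^sub>R matrix_inv (A $ i)) \<in> pd_matrices"
    and "harmonic_average lam A \<in> pd_matrices"
proof -
  show "(\<Sum>i\<in>UNIV. lam $ i *\<^sub>R matrix_inv (A $ i)) \<in> pd_matrices"
    using assms by (intro pd_sum pd_scaleR pd_inv) (auto simp: pd_tuples_def)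
  then show "harmonic_average lam A \<in> pd_matrices"
    by (simp add: harmonic_average_def pd_inv)
qed

text \<open>This is the Lagrange stationary point of the constrained problem: all A_i y_i must equal
  one common multiplier, and the constraint forces that multiplier to be H x.\<close>

definition harmonic_minimizer :: "real^'n \<Rightarrow> real^'m^'m^'n \<Rightarrow> real^'m \<Rightarrow> 'n \<Rightarrow> real^'m" where
  "harmonic_minimizer lam A x i = matrix_inv (A $ i) *v (harmonic_average lam A *v x)"

text \<open>Feasibility: factoring out H x leaves the weighted sum of the A_i^-1, whose inverse is
  H.\<close>

lemma harmonic_minimizer_sum:
  assumes "\<And>i. 0 < lam $ i" "A \<in> pd_tuples"
  shows "(\<Sum>i\<in>UNIV. lam $ i *\<^sub>R harmonic_minimizer lam A x i) = x"
proof -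
  let ?M = "\<Sum>i\<in>UNIV. lam $ i *\<^sub>R matrix_inv (A $ i)"
  have "(\<Sum>i\<in>UNIV. lam $ i *\<^sub>R harmonic_minimizer lam A x i) = ?M *v (matrix_inv ?M *v x)"
    by (simp add: harmonic_minimizer_def harmonic_average_def sum_matrix_vector_mult
        scaleR_matrix_vector_mult)
  also have "\<dots> = x"
    using harmonic_average_pd(1)[OF assms] by simp
  finally show ?thesis .
qed

text \<open>Attainment: every A_i z_i is the same vector H x, so it can be pulled out of the sum,
  and feasibility turns what remains into x.\<close>

lemma inner_harmonic_average_eq:
  assumes "\<And>i. 0 < lam $ i" "A \<in> pd_tuples"
  shows "x \<bullet> (harmonic_average lam A *v x) = (\<Sum>i\<in>UNIV. lam $ i *
    (harmonic_minimizer lam A x i \<bullet> (A $ i *v harmonic_minimizer lam A x i)))"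
proof -
  have "A $ i *v harmonic_minimizer lam A x i = harmonic_average lam A *v x" for i
    using assms(2) by (simp add: harmonic_minimizer_def pd_tuples_def)
  then have "(\<Sum>i\<in>UNIV. lam $ i *
      (harmonic_minimizer lam A x i \<bullet> (A $ i *v harmonic_minimizer lam A x i)))
    = (\<Sum>i\<in>UNIV. lam $ i *\<^sub>R harmonic_minimizer lam A x i) \<bullet> (harmonic_average lam A *v x)"
    by (simp add: inner_sum_left)
  then show ?thesis
    by (simp add: harmonic_minimizer_sum[OF assms])
qed

lemma inner_harmonic_average_le:
  assumes "\<And>i. 0 < lam $ i" "A \<in> pd_tuples" "(\<Sum>i\<in>UNIV. lam $ i *\<^sub>R y i) = x"
  shows "x \<bullet> (harmonic_average lam A *v x) \<le> (\<Sum>i\<in>UNIV. lam $ i * (y i \<bullet> (A $ i *v y i)))"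
proof -
  define z where "z = harmonic_minimizer lam A x"
  define h where "h = harmonic_average lam A *v x"
  have pd: "A $ i \<in> pd_matrices" for i
    using assms(2) by (simp add: pd_tuples_def)
  have Az: "A $ i *v z i = h" for i
    using pd by (simp add: z_def h_def harmonic_minimizer_def)
  \<comment> \<open>Symmetry of A_i together with A_i z_i = h makes the two cross terms
    equal.\<close>
  have "(y i - z i) \<bullet> (A $ i *v (y i - z i)) = y i \<bullet> (A $ i *v y i) - 2 * (y i \<bullet> h) + z i \<bullet> h" for i
  proof -
    have "z i \<bullet> (A $ i *v y i) = h \<bullet> y i"
      using pd[of i] Az[of i] by (simp add: pd_matrices_iff symmetric_matrices_iff_inner)
    then show ?thesis
      by (simp add: matrix_vector_mult_diff_distrib Az inner_simps inner_commute)
  qed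
  then have "0 \<le> y i \<bullet> (A $ i *v y i) - 2 * (y i \<bullet> h) + z i \<bullet> h" for i
    using pd_quadratic_nonneg[OF pd, of "y i - z i" i] by simp
  then have "0 \<le> (\<Sum>i\<in>UNIV. lam $ i * (y i \<bullet> (A $ i *v y i) - 2 * (y i \<bullet> h) + z i \<bullet> h))"
    using assms(1) by (intro sum_nonneg mult_nonneg_nonneg) (auto intro: less_imp_le)
  \<comment> \<open>Both weighted sums on the right equal x, so the terms in h add up to - x . h,
    which gives the bound.\<close>
  also have "\<dots> = (\<Sum>i\<in>UNIV. lam $ i * (y i \<bullet> (A $ i *v y i)))
      - 2 * ((\<Sum>i\<in>UNIV. lam $ i *\<^sub>R y i) \<bullet> h) + (\<Sum>i\<in>UNIV. lam $ i *\<^sub>R z i) \<bullet> h"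
    by (simp add: inner_sum_left sum_distrib_left sum.distrib sum_subtractf algebra_simps)
  finally show ?thesis
    using harmonic_minimizer_sum[OF assms(1,2), of x] assms(3) by (simp add: z_def h_def)
qed

section \<open>Loewner order and matrix concavity of the two averages\<close>

lemma loewner_le_iff:
  assumes "A \<in> symmetric_matrices" "B \<in> symmetric_matrices"
  shows "A \<preceq> B \<longleftrightarrow> (\<forall>x. x \<bullet> (A *v x) \<le> x \<bullet> (B *v x))"
  \<comment> \<open>The difference of symmetric matrices is symmetric, so only its quadratic form is
    left to test.\<close>
  using assms subspace_diff[OF subspace_symmetric_matrices]
  by (auto simp: loewner_le_def psd_matrices_def matrix_vector_mult_diff_rdistrib inner_simps)

theorem matrix_concave_on_harmonic_average:
  fixes lam :: "real^'n"
  assumes pos: "\<And>i. 0 < lam $ i"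
  shows "matrix_concave_on (pd_tuples :: (real^'m^'m^'n) set) (harmonic_average lam)"
proof -
  let ?H = "harmonic_average lam :: real^'m^'m^'n \<Rightarrow> _"
  have sym: "?H A \<in> symmetric_matrices" if "A \<in> pd_tuples" for A
    using harmonic_average_pd(2)[OF pos that] by (simp add: pd_matrices_iff)
  have "t *\<^sub>R ?H A + (1 - t) *\<^sub>R ?H B \<preceq> ?H (t *\<^sub>R A + (1 - t) *\<^sub>R B)"
    if A: "A \<in> pd_tuples" and B: "B \<in> pd_tuples" and t: "0 \<le> t" "t \<le> 1" for A B t
  proof -
    let ?C = "t *\<^sub>R A + (1 - t) *\<^sub>R B"
    have C: "?C \<in> pd_tuples"
      using convexD[OF convex_pd_tuples A B] t by simp
    have "x \<bullet> ((t *\<^sub>R ?H A + (1 - t) *\<^sub>R ?H B) *v x) \<le> x \<bullet> (?H ?C *v x)" for x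
    proof -
      \<comment> \<open>The constraint does not involve the matrices, so the minimizer for
        \<open>?C\<close> is also feasible for \<open>A\<close> and for \<open>B\<close>. It yields
        upper bounds for the forms of \<open>?H A\<close> and \<open>?H B\<close>, and equality for
        \<open>?H ?C\<close>.\<close>
      let ?z = "harmonic_minimizer lam ?C x"
      let ?q = "\<lambda>A. \<Sum>i\<in>UNIV. lam $ i * (?z i \<bullet> (A $ i *v ?z i))"
      have z: "(\<Sum>i\<in>UNIV. lam $ i *\<^sub>R ?z i) = x"
        by (rule harmonic_minimizer_sum[OF pos C])
      have "x \<bullet> ((t *\<^sub>R ?H A + (1 - t) *\<^sub>R ?H B) *v x)
          = t * (x \<bullet> (?H A *v x)) + (1 - t) * (x \<bullet> (?H B *v x))"
        by (simp add: matrix_vector_mult_add_rdistrib scaleR_matrix_vector_mult inner_simps)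
      also have "\<dots> \<le> t * ?q A + (1 - t) * ?q B"
        using t by (intro add_mono mult_left_mono inner_harmonic_average_le[OF pos A z]
            inner_harmonic_average_le[OF pos B z]) auto
      \<comment> \<open>For fixed vectors \<open>?z i\<close> the objective is linear in the tuple
        of matrices.\<close>
      also have "\<dots> = ?q ?C"
        unfolding sum_distrib_left sum.distrib[symmetric]
        by (intro sum.cong refl)
          (simp add: matrix_vector_mult_add_rdistrib scaleR_matrix_vector_mult inner_simps
            distrib_left mult.left_commute)
      also have "\<dots> = x \<bullet> (?H ?C *v x)"
        by (rule inner_harmonic_average_eq[OF pos C, symmetric])
      finally show ?thesis .
    qed
    then show ?thesis
      using sym A B C subspace_symmetric_matrices
      by (subst loewner_le_iff) (auto intro!: subspace_add subspace_scale)
  qed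
  then show ?thesis
    using sym convex_pd_tuples by (auto simp: matrix_concave_on_def)
qed

theorem matrix_concave_on_resolvent_average:
  fixes lam :: "real^'n"
  assumes pos: "\<And>i. 0 < lam $ i" and "0 < \<mu>"
  shows "matrix_concave_on (pd_tuples :: (real^'m^'m^'n) set) (resolvent_average \<mu> lam)"
proof -
  let ?R = "resolvent_average \<mu> lam :: real^'m^'m^'n \<Rightarrow> _"
  define E :: "real^'m^'m" where "E = inverse \<mu> *\<^sub>R mat 1"
  define S :: "real^'m^'m^'n \<Rightarrow> real^'m^'m^'n" where "S = (\<lambda>A. A + (\<chi> i. E))"
  have E: "E \<in> pd_matrices"
    using assms(2) by (simp add: E_def pd_scaleR mat_1_pd)
  have res: "?R A = harmonic_average lam (S A) - E" for A
    by (simp add: resolvent_average_def harmonic_average_def S_def E_def)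
  have S: "S A \<in> pd_tuples" if "A \<in> pd_tuples" for A
    using that E by (simp add: S_def pd_tuples_def pd_add)
  \<comment> \<open>The shift is affine: the weights t and 1 - t sum to one, so the constant tuple
    is reproduced exactly. The same cancellation handles the subtracted \<open>E\<close>
    below.\<close>
  have S_convex: "S (t *\<^sub>R A + (1 - t) *\<^sub>R B) = t *\<^sub>R S A + (1 - t) *\<^sub>R S B" for t A B
    by (simp add: S_def algebra_simps)
  have "?R A \<in> symmetric_matrices" if "A \<in> pd_tuples" for A
    using harmonic_average_pd(2)[OF pos S[OF that]] E
    by (simp add: res pd_matrices_iff subspace_diff[OF subspace_symmetric_matrices])
  moreover have "t *\<^sub>R ?R A + (1 - t) *\<^sub>R ?R B
      \<preceq> ?R (t *\<^sub>R A + (1 - t) *\<^sub>R B)"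
    if "A \<in> pd_tuples" "B \<in> pd_tuples" "0 \<le> t" "t \<le> 1" for A B t
  proof -
    have "t *\<^sub>R harmonic_average lam (S A) + (1 - t) *\<^sub>R harmonic_average lam (S B)
        \<preceq> harmonic_average lam (t *\<^sub>R S A + (1 - t) *\<^sub>R S B)"
      using matrix_concave_on_harmonic_average[OF pos] S that by (auto simp: matrix_concave_on_def)
    moreover have "t *\<^sub>R ?R A + (1 - t) *\<^sub>R ?R B
        = t *\<^sub>R harmonic_average lam (S A) + (1 - t) *\<^sub>R harmonic_average lam (S B) - E"
      by (simp add: res algebra_simps)
    ultimately show ?thesis
      unfolding loewner_le_def by (simp only: res S_convex diff_diff_eq2 diff_add_cancel)
  qed
  ultimately show ?thesis
    using convex_pd_tuples by (auto simp: matrix_concave_on_def)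
qed

section \<open>Scalar case through multiples of the identity\<close>

lemma matrix_inv_scaleR_mat_1:
  assumes "c \<noteq> 0"
  shows "matrix_inv (c *\<^sub>R mat 1 :: real^'m^'m) = inverse c *\<^sub>R mat 1"
  by (rule matrix_inv_unique)
    (use assms in \<open>simp_all add: scalar_matrix_assoc[symmetric] matrix_scalar_ac\<close>)

text \<open>Both quadratic forms are multiples of x . x; testing at the all-ones vector, whose
  squared norm is positive, recovers the scalar inequality.\<close>

lemma loewner_le_scaleR_mat_1:
  "a *\<^sub>R mat 1 \<preceq> (b *\<^sub>R mat 1 :: real^'m^'m) \<longleftrightarrow> a \<le> b"
proof -
  have "0 < (1 :: real^'m) \<bullet> 1"
    by (simp add: vec_eq_iff)
  then show ?thesis
    by (subst loewner_le_iff)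
      (auto simp: subspace_scale[OF subspace_symmetric_matrices] mat_1_symmetric
        scaleR_matrix_vector_mult mult_right_mono dest: spec[of _ 1])
qed

theorem concave_on_reciprocal_sum_inverse:
  "concave_on {x :: real^'n. \<forall>i. 0 < x $ i} (\<lambda>x. 1 / (\<Sum>i\<in>UNIV. inverse (x $ i)))"
proof -
  let ?D = "{x :: real^'n. \<forall>i. 0 < x $ i}"
  let ?f = "\<lambda>x :: real^'n. 1 / (\<Sum>i\<in>UNIV. inverse (x $ i))"
  \<comment> \<open>Numbers are embedded as 1 x 1 matrices. In \<open>harmonic_average 1\<close> the
    weight vector \<open>1\<close> has all entries one, so no factor n appears in the
    denominator.\<close>
  define T :: "real^'n \<Rightarrow> real^1^1^'n" where "T = (\<lambda>x. \<chi> i. x $ i *\<^sub>R mat 1)"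
  have concave: "matrix_concave_on (pd_tuples :: (real^1^1^'n) set) (harmonic_average 1)"
    by (rule matrix_concave_on_harmonic_average) simp
  have convex: "convex ?D"
    by (rule convex_box_cart) (simp add: greaterThan_def[symmetric])
  have T_pd: "T x \<in> pd_tuples" if "x \<in> ?D" for x
    using that by (simp add: T_def pd_tuples_def pd_scaleR mat_1_pd)
  have T_convex: "T (u *\<^sub>R x + v *\<^sub>R y) = u *\<^sub>R T x + v *\<^sub>R T y" for u v x y
    by (simp add: T_def vec_eq_iff algebra_simps)
  have H: "harmonic_average 1 (T x) = ?f x *\<^sub>R mat 1" if "x \<in> ?D" for x
  proof -
    have "x $ i \<noteq> 0" for i
      using that by (metis less_irrefl mem_Collect_eq)
    \<comment> \<open>Inversion happens twice, first for each x_i and then for the sum of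
      reciprocals, so this sum must be nonzero as well.\<close>
    moreover have "0 < (\<Sum>i\<in>UNIV. inverse (x $ i))"
      using that by (intro sum_pos) auto
    ultimately show ?thesis
      by (simp add: harmonic_average_def T_def matrix_inv_scaleR_mat_1
          scaleR_left.sum[symmetric] divide_inverse)
  qed
  have "u * ?f x + v * ?f y \<le> ?f (u *\<^sub>R x + v *\<^sub>R y)"
    if xy: "x \<in> ?D" "y \<in> ?D" and uv: "0 \<le> u" "0 \<le> v" "u + v = 1" for x y u v
  proof -
    have v: "v = 1 - u" and "u \<le> 1"
      using uv by auto
    have "u *\<^sub>R harmonic_average 1 (T x) + v *\<^sub>R harmonic_average 1 (T y)
        \<preceq> harmonic_average 1 (u *\<^sub>R T x + v *\<^sub>R T y)"
      using concave T_pd[OF xy(1)] T_pd[OF xy(2)] uv(1) \<open>u \<le> 1\<close>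
      unfolding v matrix_concave_on_def by blast
    moreover have "u *\<^sub>R x + v *\<^sub>R y \<in> ?D"
      by (rule convexD[OF convex xy uv])
    ultimately have "(u * ?f x + v * ?f y) *\<^sub>R (mat 1 :: real^1^1)
        \<preceq> ?f (u *\<^sub>R x + v *\<^sub>R y) *\<^sub>R mat 1"
      using H[OF xy(1)] H[OF xy(2)] H[of "u *\<^sub>R x + v *\<^sub>R y"]
      by (simp only: T_convex scaleR_add_left scaleR_scaleR)
    then show ?thesis
      by (simp only: loewner_le_scaleR_mat_1)
  qed
  then show ?thesis
    using convex unfolding concave_on_iff by blast
qed

theorem corollary4p5:
  fixes lam :: "real^'n"
  assumes "\<And>i. 0 < lam $ i"
    and "(\<Sum>i\<in>UNIV. lam $ i) = 1"
  shows "(\<forall>\<mu>>0. matrix_concave_on (pd_tuples :: (real^'m^'m^'n) set) (resolvent_average \<mu> lam))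
    \<and> matrix_concave_on (pd_tuples :: (real^'m^'m^'n) set) (harmonic_average lam)
    \<and> concave_on {x :: real^'n. \<forall>i. 0 < x $ i} (\<lambda>x. 1 / (\<Sum>i\<in>UNIV. inverse (x $ i)))"
  using assms(1) matrix_concave_on_resolvent_average matrix_concave_on_harmonic_average
    concave_on_reciprocal_sum_inverse by blast

end
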